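(* For all formulas $\varphi,\psi$ in the $\{\wedge,\vee,\neg\}$-fragment (embedded in $\mathsf{Form}$ via $\neg\alpha:=\alpha\to\bot$): $\varphi\vdash_{\mathsf F}\psi$ if and only if $\varphi\vdash_{\mathcal F}\psi$, where $\vdash_{\mathcal F}$ is fundamental logic.
   Context: **Language.** $\mathsf{Prop}$ is a countable set of propositional variables; $\mathsf{Form}$ is generated by $\varphi::=p\mid\bot\mid\top\mid(\varphi\wedge\varphi)\mid(\varphi\vee\varphi)\mid(\varphi\to\varphi)$, $p\in\mathsf{Prop}$, and $\neg\alpha:=\alpha\to\bot$. **Fundamental logic.** The $\{\wedge,\vee,\neg\}$-language is generated from $\mathsf{Prop}$ by $\wedge,\vee,\neg$. An *intro-elim logic* is a binary relation $\vdash$ on formulas of this language such that for all $\varphi,\psi,\chi$: $\varphi\vdash\varphi$; if $\varphi\vdash\psi$ and $\psi\vdash\chi$ then $\varphi\vdash\chi$; $\varphi\wedge\psi\vdash\varphi$ and $\varphi\wedge\psi\vdash\psi$; if $\varphi\vdash\psi$ and $\varphi\vdash\chi$ then $\varphi\vdash\psi\wedge\chi$; $\varphi\vdash\varphi\vee\psi$ and $\psi\vdash\varphi\vee\psi$; if $\varphi\vdash\chi$ and $\psi\vdash\chi$ then $\varphi\vee\psi\vdash\chi$; $\varphi\vdash\neg\neg\varphi$; $\varphi\wedge\neg\varphi\vdash\psi$; if $\varphi\vdash\psi$ then $\neg\psi\vdash\neg\varphi$. Fundamental logic $\vdash_{\mathcal F}$ is the smallest intro-elim logic. **System $\mathsf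 F$.** $\vdash_{\mathsf F}$ is the smallest relation ${\vdash}\subseteq\wp(\mathsf{Form})\times\mathsf{Form}$ satisfying the following for all sets $\Gamma,\Delta\subseteq\mathsf{Form}$ and all formulas (where $\Gamma,\varphi\vdash\psi$ means $\Gamma\cup\{\varphi\}\vdash\psi$, $\varphi\vdash\psi$ means $\{\varphi\}\vdash\psi$, $\vdash\varphi$ means $\varnothing\vdash\varphi$, and $\alpha\dashv\vdash\beta$ means $\alpha\vdash\beta$ and $\beta\vdash\alpha$): (A) $\Gamma,\varphi\vdash\varphi$; (Cut) if $\Gamma,\psi\vdash\varphi$ and $\Delta\vdash\psi$ then $\Gamma\cup\Delta\vdash\varphi$; ($\wedge$I) $\{\varphi,\psi\}\vdash\varphi\wedge\psi$; ($\wedge$E) $\varphi\wedge\psi\vdash\varphi$ and $\varphi\wedge\psi\vdash\psi$; ($\vee$I) $\varphi\vdash\varphi\vee\psi$ and $\psi\vdash\varphi\vee\psi$; ($\vee$E) if $\varphi\vdash\alpha$ and $\psi\vdash\alpha$ then $\varphi\vee\psi\vdash\alpha$; ($\bot$E) $\bot\vdash\varphi$; ($\top$) $\vdash\top$; ($\top\to$E) $\top\to\varphi\vdash\varphi$; (Con) if $\alpha\wedge\beta\vdash\psi$ then $\alpha\to\beta\vdash\alpha\to\psi$; ($\wedge{\vdash}\to$) $\alpha\wedge\beta\vdash\alpha\to\beta$; (Imp) if $\alpha\wedge\beta\vdash\varphi$ then $\varphi\to(\alpha\to\beta)\vdash(\varphi\wedge\alpha)\to\beta$; (Rep) if $\alpha\dashv\vdash\alpha'$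 then $\alpha\to\beta\dashv\vdash\alpha'\to\beta$; ($\to$Id) $\vdash\alpha\to\alpha$; (Exp) $\{\alpha,\neg\alpha\}\vdash\bot$; ($\neg\neg$I) $\alpha\vdash\neg\neg\alpha$. *)

theory Defs
  imports "HOL-Library.Countable"
begin

datatype 'p form =
    Var 'p
  | Falsum  ("\<^bold>\<bottom>")
  | Verum   ("\<^bold>\<top>")
  | Conj "'p form" "'p form"  (infixr "\<^bold>\<and>" 75)
  | Disj "'p form" "'p form"  (infixr "\<^bold>\<or>" 70)
  | Impl "'p form" "'p form"  (infixr "\<^bold>\<rightarrow>" 65)

abbreviation Neg :: "'p form \<Rightarrow> 'p form"  ("\<^bold>\<not> _" [80] 80) where
  "\<^bold>\<not> \<alpha> \<equiv> \<alpha> \<^bold>\<rightarrow> \<^bold>\<bottom>"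

text \<open>The system \<open>F\<close>. The set of premises is an arbitrary, possibly infinite set.\<close>

inductive F_derives :: "'p form set \<Rightarrow> 'p form \<Rightarrow> bool"  (infix "\<turnstile>F" 50) where
  A:        "insert \<phi> \<Gamma> \<turnstile>F \<phi>"
| Cut:      "insert \<psi> \<Gamma> \<turnstile>F \<phi> \<Longrightarrow> \<Delta> \<turnstile>F \<psi> \<Longrightarrow> \<Gamma> \<union> \<Delta> \<turnstile>F \<phi>"
| ConjI:    "{\<phi>, \<psi>} \<turnstile>F \<phi> \<^bold>\<and> \<psi>"
| ConjE1:   "{\<phi> \<^bold>\<and> \<psi>} \<turnstile>F \<phi>"
| ConjE2:   "{\<phi> \<^bold>\<and> \<psi>} \<turnstile>F \<psi>"
| DisjI1:   "{\<phi>} \<turnstile>F \<phi> \<^bold>\<or> \<psi>"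
| DisjI2:   "{\<psi>} \<turnstile>F \<phi> \<^bold>\<or> \<psi>"
| DisjE:    "{\<phi>} \<turnstile>F \<alpha> \<Longrightarrow> {\<psi>} \<turnstile>F \<alpha> \<Longrightarrow> {\<phi> \<^bold>\<or> \<psi>} \<turnstile>F \<alpha>"
| FalsumE:  "{\<^bold>\<bottom>} \<turnstile>F \<phi>"
| VerumI:   "{} \<turnstile>F \<^bold>\<top>"
| VerumImplE: "{\<^bold>\<top> \<^bold>\<rightarrow> \<phi>} \<turnstile>F \<phi>"
| Con:      "{\<alpha> \<^bold>\<and> \<beta>} \<turnstile>F \<psi> \<Longrightarrow> {\<alpha> \<^bold>\<rightarrow> \<beta>} \<turnstile>F \<alpha> \<^bold>\<rightarrow> \<psi>"
| ConjImpl: "{\<alpha> \<^bold>\<and> \<beta>} \<turnstile>F \<alpha> \<^bold>\<rightarrow> \<beta>"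
| Imp:      "{\<alpha> \<^bold>\<and> \<beta>} \<turnstile>F \<phi> \<Longrightarrow> {\<phi> \<^bold>\<rightarrow> (\<alpha> \<^bold>\<rightarrow> \<beta>)} \<turnstile>F (\<phi> \<^bold>\<and> \<alpha>) \<^bold>\<rightarrow> \<beta>"
| Rep1:     "{\<alpha>} \<turnstile>F \<alpha>' \<Longrightarrow> {\<alpha>'} \<turnstile>F \<alpha> \<Longrightarrow> {\<alpha> \<^bold>\<rightarrow> \<beta>} \<turnstile>F \<alpha>' \<^bold>\<rightarrow> \<beta>"
| Rep2:     "{\<alpha>} \<turnstile>F \<alpha>' \<Longrightarrow> {\<alpha>'} \<turnstile>F \<alpha> \<Longrightarrow> {\<alpha>' \<^bold>\<rightarrow> \<beta>} \<turnstile>F \<alpha> \<^bold>\<rightarrow> \<beta>"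
| ImplId:   "{} \<turnstile>F \<alpha> \<^bold>\<rightarrow> \<alpha>"
| Exp:      "{\<alpha>, \<^bold>\<not> \<alpha>} \<turnstile>F \<^bold>\<bottom>"
| NegNegI:  "{\<alpha>} \<turnstile>F \<^bold>\<not> (\<^bold>\<not> \<alpha>)"

text \<open>The language with primitive conjunction, disjunction and negation only, and
  fundamental logic, the least intro-elim logic, on it.\<close>

datatype 'p nform =
    NVar 'p
  | NConj "'p nform" "'p nform"
  | NDisj "'p nform" "'p nform"
  | NNeg "'p nform"

inductive fundamental :: "'p nform \<Rightarrow> 'p nform \<Rightarrow> bool"  (infix "\<turnstile>fund" 50) where
  refl:    "\<phi> \<turnstile>fund \<phi>"
| trans:   "\<phi> \<turnstile>fund \<psi> \<Longrightarrow> \<psi> \<turnstile>fund \<chi> \<Longrightarrow> \<phi> \<turnstile>fund \<chi>"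
| conjE1:  "NConj \<phi> \<psi> \<turnstile>fund \<phi>"
| conjE2:  "NConj \<phi> \<psi> \<turnstile>fund \<psi>"
| conjI:   "\<phi> \<turnstile>fund \<psi> \<Longrightarrow> \<phi> \<turnstile>fund \<chi> \<Longrightarrow> \<phi> \<turnstile>fund NConj \<psi> \<chi>"
| disjI1:  "\<phi> \<turnstile>fund NDisj \<phi> \<psi>"
| disjI2:  "\<psi> \<turnstile>fund NDisj \<phi> \<psi>"
| disjE:   "\<phi> \<turnstile>fund \<chi> \<Longrightarrow> \<psi> \<turnstile>fund \<chi> \<Longrightarrow> NDisj \<phi> \<psi> \<turnstile>fund \<chi>"
| negnegI: "\<phi> \<turnstile>fund NNeg (NNeg \<phi>)"
| negE:    "NConj \<phi> (NNeg \<phi>) \<turnstile>fund \<psi>"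
| contra:  "\<phi> \<turnstile>fund \<psi> \<Longrightarrow> NNeg \<psi> \<turnstile>fund NNeg \<phi>"

primrec embed :: "'p nform \<Rightarrow> 'p form" where
  "embed (NVar p) = Var p"
| "embed (NConj \<phi> \<psi>) = embed \<phi> \<^bold>\<and> embed \<psi>"
| "embed (NDisj \<phi> \<psi>) = embed \<phi> \<^bold>\<or> embed \<psi>"
| "embed (NNeg \<phi>) = \<^bold>\<not> (embed \<phi>)"

end

theory Submission imports Defs begin

text \<open>
  From right to left, each closure condition of fundamental logic is derivable in the system
  \<open>F\<close>. Only contraposition takes an argument, because \<open>F\<close> has no deduction theorem and no modus
  ponens for the conditional (see \<open>F_contraposition\<close>).

  From left to right, the proof is semantic. A frame carries a relation \<open>y \<lhd> x\<close>, read as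
  ``\<open>x\<close> is open to \<open>y\<close>''. Propositions are the fixed points of the closure operator
  \<open>{x. \<forall>y \<lhd> x. \<exists>z. y \<lhd> z \<and> z \<in> A}\<close>, and \<open>A \<rightarrow> B\<close> holds at \<open>x\<close> if every \<open>y \<lhd> x\<close> in \<open>A\<close> has some
  \<open>z\<close> with \<open>y \<lhd> z\<close> in \<open>A \<inter> B\<close>. Over reflexive and pseudosymmetric frames all rules of \<open>F\<close> are
  sound (\<open>soundness\<close>), and negation becomes \<open>\<not> A = {x. \<forall>y \<lhd> x. y \<notin> A}\<close>, which no longer mentions
  the conditional. It therefore suffices to refute each unprovable sequent of fundamental
  logic in such a frame.

  The refuting frame is built from fundamental logic itself. A world is a pair \<open>(a, b)\<close> of formulas,
  where \<open>a\<close> generates the filter of what is accepted and \<open>b\<close> the ideal of what is rejected;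
  a world is consistent (\<open>a\<close> does not entail \<open>b\<close>) and rejects the negation of what it accepts
  (\<open>\<not> a \<turnstile> b\<close>). A world is open to another if it accepts nothing that the other one rejects. At a
  world \<open>(a, b)\<close> exactly the consequences of \<open>a\<close> are true (\<open>truth\<close>), so \<open>(\<phi>, \<not> \<phi>)\<close> refutes every
  sequent \<open>\<phi> \<turnstile> \<psi>\<close> that is not provable. The usual construction takes arbitrary filters and ideals;
  principal ones are enough, since every world whose existence is needed is given by one or two
  explicit formulas.
\<close>

section \<open>Fundamental logic inside the system F\<close>

lemma F_trans:
  assumes "{\<alpha>} \<turnstile>F \<beta>" and "{\<beta>} \<turnstile>F \<gamma>"
  shows "{\<alpha>} \<turnstile>F \<gamma>"
  using F_derives.Cut[of \<beta> "{}" \<gamma> "{\<alpha>}"] assms by simp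

lemma F_cut2:
  assumes "{\<beta>, \<gamma>} \<turnstile>F \<delta>" and "{\<alpha>} \<turnstile>F \<beta>" and "{\<alpha>} \<turnstile>F \<gamma>"
  shows "{\<alpha>} \<turnstile>F \<delta>"
proof -
  have "{\<gamma>, \<alpha>} \<turnstile>F \<delta>"
    using F_derives.Cut[OF assms(1) assms(2)] by (simp add: insert_commute)
  from F_derives.Cut[OF this assms(3)] show ?thesis by simp
qed

lemma F_refl: "{\<alpha>} \<turnstile>F \<alpha>"
  using F_derives.A[of \<alpha> "{}"] by simp

lemma F_conjI: "{\<alpha>} \<turnstile>F \<beta> \<Longrightarrow> {\<alpha>} \<turnstile>F \<gamma> \<Longrightarrow> {\<alpha>} \<turnstile>F \<beta> \<^bold>\<and> \<gamma>"
  by (rule F_cut2[OF F_derives.ConjI])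

text \<open>
  The rules allow the antecedent of a conditional to be replaced only by an equivalent formula.
  Since \<open>\<alpha>\<close> entails \<open>\<beta>\<close>, it is equivalent to \<open>\<beta> \<and> \<alpha>\<close>, and it remains to weaken \<open>\<not> \<beta>\<close> to
  \<open>\<not> (\<beta> \<and> \<alpha>)\<close>. This is importation applied to \<open>\<beta> \<rightarrow> \<not> \<alpha>\<close>, which follows from \<open>\<beta> \<rightarrow> \<bottom>\<close>
  by weakening the consequent.
\<close>

lemma F_contraposition:
  assumes "{\<alpha>} \<turnstile>F \<beta>"
  shows "{\<^bold>\<not> \<beta>} \<turnstile>F \<^bold>\<not> \<alpha>"
proof -
  have "{\<beta> \<^bold>\<and> \<^bold>\<bottom>} \<turnstile>F \<^bold>\<not> \<alpha>"
    by (rule F_trans[OF F_derives.ConjE2 F_derives.FalsumE])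
  hence 1: "{\<^bold>\<not> \<beta>} \<turnstile>F \<beta> \<^bold>\<rightarrow> \<^bold>\<not> \<alpha>"
    by (rule F_derives.Con)
  have "{\<alpha> \<^bold>\<and> \<^bold>\<bottom>} \<turnstile>F \<beta>"
    by (rule F_trans[OF F_derives.ConjE2 F_derives.FalsumE])
  hence 2: "{\<beta> \<^bold>\<rightarrow> \<^bold>\<not> \<alpha>} \<turnstile>F \<^bold>\<not> (\<beta> \<^bold>\<and> \<alpha>)"
    by (rule F_derives.Imp)
  have 3: "{\<^bold>\<not> (\<beta> \<^bold>\<and> \<alpha>)} \<turnstile>F \<^bold>\<not> \<alpha>"
    by (rule F_derives.Rep1[OF F_derives.ConjE2 F_conjI[OF assms F_refl]])
  show ?thesis
    by (rule F_trans[OF F_trans[OF 1 2] 3])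
qed

lemma F_contradiction: "{\<alpha> \<^bold>\<and> \<^bold>\<not> \<alpha>} \<turnstile>F \<beta>"
  by (rule F_trans[OF F_cut2[OF F_derives.Exp F_derives.ConjE1 F_derives.ConjE2]
        F_derives.FalsumE])

lemma fundamental_imp_F:
  assumes "\<phi> \<turnstile>fund \<psi>"
  shows "{embed \<phi>} \<turnstile>F embed \<psi>"
  using assms
  by induction
    (auto intro: F_refl F_trans F_conjI F_contraposition F_contradiction F_derives.ConjE1
      F_derives.ConjE2 F_derives.DisjI1 F_derives.DisjI2 F_derives.DisjE F_derives.NegNegI)

section \<open>Relational semantics for the system F\<close>

text \<open>
  Pseudosymmetry weakens symmetry: \<open>y \<lhd> x\<close> yields \<open>z \<lhd> y\<close> not for \<open>z = x\<close> but for some \<open>z\<close> that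
  is open to no more worlds than \<open>x\<close>, and at which therefore every proposition true at \<open>x\<close> is true.
\<close>

locale frame =
  fixes W :: "'w set" and open_to :: "'w \<Rightarrow> 'w \<Rightarrow> bool"  (infix "\<lhd>" 50)
  assumes worlds: "y \<lhd> x \<Longrightarrow> y \<in> W \<and> x \<in> W"
    and reflexive: "x \<in> W \<Longrightarrow> x \<lhd> x"
    and pseudosymmetric: "y \<lhd> x \<Longrightarrow> \<exists>z. z \<lhd> y \<and> (\<forall>w. w \<lhd> z \<longrightarrow> w \<lhd> x)"
begin

definition cl :: "'w set \<Rightarrow> 'w set" where
  "cl A = {x \<in> W. \<forall>y. y \<lhd> x \<longrightarrow> (\<exists>z\<in>A. y \<lhd> z)}"

definition cond :: "'w set \<Rightarrow> 'w set \<Rightarrow> 'w set" where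
  "cond A B = {x \<in> W. \<forall>y\<in>A. y \<lhd> x \<longrightarrow> (\<exists>z \<in> A \<inter> B. y \<lhd> z)}"

primrec sem :: "('p \<Rightarrow> 'w set) \<Rightarrow> 'p form \<Rightarrow> 'w set" where
  "sem V (Var p) = cl (V p)"
| "sem V \<^bold>\<bottom> = {}"
| "sem V \<^bold>\<top> = W"
| "sem V (\<alpha> \<^bold>\<and> \<beta>) = sem V \<alpha> \<inter> sem V \<beta>"
| "sem V (\<alpha> \<^bold>\<or> \<beta>) = cl (sem V \<alpha> \<union> sem V \<beta>)"
| "sem V (\<alpha> \<^bold>\<rightarrow> \<beta>) = cond (sem V \<alpha>) (sem V \<beta>)"

lemma cl_mono: "A \<subseteq> B \<Longrightarrow> cl A \<subseteq> cl B"
  unfolding cl_def by blast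

lemma cl_idem: "cl (cl A) \<subseteq> cl A"
  unfolding cl_def by blast

lemma cl_extensive: "A \<subseteq> W \<Longrightarrow> A \<subseteq> cl A"
  unfolding cl_def by blast

lemma cl_empty: "cl {} = {}"
  unfolding cl_def using reflexive by blast

lemma cl_cond: "cl (cond A B) \<subseteq> cond A B"
  unfolding cl_def cond_def by blast

lemma cond_empty: "cond A {} = {x \<in> W. \<forall>y. y \<lhd> x \<longrightarrow> y \<notin> A}"
  unfolding cond_def by blast

lemma sem_worlds: "sem V \<phi> \<subseteq> W"
  by (induction \<phi>) (auto simp: cl_def cond_def)

lemma sem_closed: "cl (sem V \<phi>) \<subseteq> sem V \<phi>"
proof (induction \<phi>)
  case (Conj \<alpha> \<beta>)
  have "cl (sem V \<alpha> \<inter> sem V \<beta>) \<subseteq> cl (sem V \<alpha>) \<inter> cl (sem V \<beta>)"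
    by (simp add: cl_mono)
  with Conj.IH show ?case by auto
qed (use cl_idem cl_cond cl_empty in \<open>auto simp: cl_def\<close>)

lemma cond_import:
  assumes "A \<inter> B \<subseteq> C"
  shows "cond C (cond A B) \<subseteq> cond (C \<inter> A) B"
proof
  fix x assume x: "x \<in> cond C (cond A B)"
  have "\<exists>w \<in> C \<inter> A \<inter> B. y \<lhd> w" if y: "y \<in> C \<inter> A" "y \<lhd> x" for y
  proof -
    obtain z where "z \<in> cond A B" "y \<lhd> z"
      using x y unfolding cond_def by blast
    then obtain w where "w \<in> A \<inter> B" "y \<lhd> w"
      using y unfolding cond_def by blast
    with assms show ?thesis by blast
  qed
  with x show "x \<in> cond (C \<inter> A) B"
    unfolding cond_def by blast
qed

lemma double_negation:
  assumes "cl A \<subseteq> A" and "A \<subseteq> W"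
  shows "A \<subseteq> cond (cond A {}) {}"
proof
  fix x assume x: "x \<in> A"
  have "y \<notin> cond A {}" if "y \<lhd> x" for y
  proof -
    obtain z where z: "z \<lhd> y" "\<forall>w. w \<lhd> z \<longrightarrow> w \<lhd> x"
      using pseudosymmetric \<open>y \<lhd> x\<close> by blast
    have "z \<in> cl A"
      using z worlds x unfolding cl_def by blast
    with assms(1) z(1) show ?thesis
      unfolding cond_empty by blast
  qed
  with x assms(2) show "x \<in> cond (cond A {}) {}"
    unfolding cond_empty[of "cond A {}"] by blast
qed

theorem soundness:
  assumes "\<Gamma> \<turnstile>F \<phi>"
  shows "W \<inter> (\<Inter>\<gamma>\<in>\<Gamma>. sem V \<gamma>) \<subseteq> sem V \<phi>"
  using assms
proof induction
  case (DisjI1 \<phi> \<psi>)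
  show ?case using cl_extensive[of "sem V \<phi> \<union> sem V \<psi>"] sem_worlds by auto
next
  case (DisjI2 \<psi> \<phi>)
  show ?case using cl_extensive[of "sem V \<phi> \<union> sem V \<psi>"] sem_worlds by auto
next
  case (DisjE \<phi> \<alpha> \<psi>)
  hence "sem V \<phi> \<union> sem V \<psi> \<subseteq> sem V \<alpha>"
    using sem_worlds by fastforce
  from cl_mono[OF this] show ?case using sem_closed by fastforce
next
  case (VerumImplE \<phi>)
  have "cond W (sem V \<phi>) \<subseteq> cl (sem V \<phi>)"
    unfolding cond_def cl_def using worlds by blast
  thus ?case using sem_closed by fastforce
next
  case (Con \<alpha> \<beta> \<psi>)
  hence "sem V \<alpha> \<inter> sem V \<beta> \<subseteq> sem V \<psi>"
    using sem_worlds by fastforce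
  hence "cond (sem V \<alpha>) (sem V \<beta>) \<subseteq> cond (sem V \<alpha>) (sem V \<psi>)"
    unfolding cond_def by blast
  thus ?case by auto
next
  case (ConjImpl \<alpha> \<beta>)
  show ?case by (auto simp: cond_def)
next
  case (Imp \<alpha> \<beta> \<phi>)
  hence "sem V \<alpha> \<inter> sem V \<beta> \<subseteq> sem V \<phi>"
    using sem_worlds by fastforce
  from cond_import[OF this] show ?case by auto
next
  case (Rep1 \<alpha> \<alpha>' \<beta>)
  hence "sem V \<alpha> = sem V \<alpha>'"
    using sem_worlds by fastforce
  thus ?case by simp
next
  case (Rep2 \<alpha> \<alpha>' \<beta>)
  hence "sem V \<alpha> = sem V \<alpha>'"
    using sem_worlds by fastforce
  thus ?case by simp
next
  case (ImplId \<alpha>)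
  show ?case using reflexive worlds by (auto simp: cond_def)
next
  case (Exp \<alpha>)
  show ?case using reflexive by (auto simp: cond_empty)
next
  case (NegNegI \<alpha>)
  show ?case using double_negation[OF sem_closed sem_worlds] by auto
qed auto

end

section \<open>The canonical frame of fundamental logic\<close>

lemma fund_contradiction: "\<phi> \<turnstile>fund \<psi> \<Longrightarrow> \<phi> \<turnstile>fund NNeg \<psi> \<Longrightarrow> \<phi> \<turnstile>fund \<chi>"
  by (rule fundamental.trans[OF fundamental.conjI fundamental.negE])

text \<open>
  The language has no constant for truth; the negation of any contradiction serves as one.
\<close>

lemma fund_noncontradiction: "\<chi> \<turnstile>fund NNeg (NConj \<phi> (NNeg \<phi>))"
  by (rule fundamental.trans[OF fundamental.negnegI fundamental.contra[OF fundamental.negE]])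

definition world :: "'p nform \<times> 'p nform \<Rightarrow> bool" where
  "world x \<longleftrightarrow> NNeg (fst x) \<turnstile>fund snd x \<and> \<not> fst x \<turnstile>fund snd x"

definition canon :: "'p nform \<times> 'p nform \<Rightarrow> 'p nform \<times> 'p nform \<Rightarrow> bool" where
  "canon y x \<longleftrightarrow> world y \<and> world x \<and> \<not> fst x \<turnstile>fund snd y"

definition accepts :: "'p nform \<Rightarrow> ('p nform \<times> 'p nform) set" where
  "accepts \<phi> = {x. world x \<and> fst x \<turnstile>fund \<phi>}"

text \<open>
  This is the least committed way to accept \<open>a\<close>: beyond \<open>a\<close> it rejects only what every world that
  accepts \<open>a\<close> must reject.
\<close>

lemma world_neg:
  assumes "\<not> a \<turnstile>fund \<chi>"
  shows "world (a, NNeg a)"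
  using assms fund_contradiction[OF fundamental.refl, of a \<chi>]
  unfolding world_def by (auto intro: fundamental.refl)

text \<open>
  For pseudosymmetry, the world \<open>(a, \<not> a)\<close> replaces \<open>x = (a, b)\<close>. It accepts the same formulas and is
  therefore open to the same worlds, and \<open>y\<close> is open to it: if \<open>y\<close> accepted \<open>\<not> a\<close>, then \<open>a\<close> would
  entail the negation of what \<open>y\<close> accepts, which \<open>y\<close> rejects.
\<close>

interpretation canonical: frame "Collect world" canon
proof
  fix y x :: "'a nform \<times> 'a nform"
  show "canon y x \<Longrightarrow> y \<in> Collect world \<and> x \<in> Collect world"
    by (simp add: canon_def)
  show "x \<in> Collect world \<Longrightarrow> canon x x"
    by (simp add: canon_def world_def)
  assume yx: "canon y x"
  let ?z = "(fst x, NNeg (fst x))"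
  have z: "world ?z"
    using yx world_neg unfolding canon_def by blast
  have "\<not> fst y \<turnstile>fund NNeg (fst x)"
  proof
    assume "fst y \<turnstile>fund NNeg (fst x)"
    hence "NNeg (NNeg (fst x)) \<turnstile>fund NNeg (fst y)"
      by (rule fundamental.contra)
    hence "fst x \<turnstile>fund NNeg (fst y)"
      by (rule fundamental.trans[OF fundamental.negnegI])
    thus False
      using yx unfolding canon_def world_def by (blast intro: fundamental.trans)
  qed
  hence "canon ?z y"
    using z yx unfolding canon_def by simp
  moreover have "\<forall>w. canon w ?z \<longrightarrow> canon w x"
    using yx unfolding canon_def by simp
  ultimately show "\<exists>z. canon z y \<and> (\<forall>w. canon w z \<longrightarrow> canon w x)"
    by blast
qed

text \<open>
  If \<open>x\<close> does not accept \<open>\<phi>\<close>, then it is open to the world that accepts only truths and rejects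
  just the formulas entailing \<open>\<phi>\<close>, and no world that accepts \<open>\<phi>\<close> is open to that one.
\<close>

lemma accepts_closed: "canonical.cl (accepts \<phi>) = accepts \<phi>"
proof
  show "accepts \<phi> \<subseteq> canonical.cl (accepts \<phi>)"
    by (rule canonical.cl_extensive) (auto simp: accepts_def)
  show "canonical.cl (accepts \<phi>) \<subseteq> accepts \<phi>"
  proof
    fix x assume x: "x \<in> canonical.cl (accepts \<phi>)"
    show "x \<in> accepts \<phi>"
    proof (rule ccontr)
      assume "x \<notin> accepts \<phi>"
      with x have wx: "world x" and nx: "\<not> fst x \<turnstile>fund \<phi>"
        by (auto simp: accepts_def canonical.cl_def)
      let ?top = "NNeg (NConj \<phi> (NNeg \<phi>))"
      have "NNeg ?top \<turnstile>fund \<phi>"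
        by (rule fund_contradiction[OF fund_noncontradiction fundamental.refl])
      moreover have "\<not> ?top \<turnstile>fund \<phi>"
        using nx fund_noncontradiction fundamental.trans by blast
      ultimately have "world (?top, \<phi>)"
        by (simp add: world_def)
      with wx nx have "canon (?top, \<phi>) x"
        by (simp add: canon_def)
      with x obtain z where "z \<in> accepts \<phi>" "canon (?top, \<phi>) z"
        unfolding canonical.cl_def by blast
      thus False
        by (simp add: accepts_def canon_def)
    qed
  qed
qed

lemma accepts_conj: "accepts (NConj \<phi> \<psi>) = accepts \<phi> \<inter> accepts \<psi>"
  unfolding accepts_def
  by (auto intro: fundamental.conjI fundamental.trans[OF _ fundamental.conjE1]
      fundamental.trans[OF _ fundamental.conjE2])

text \<open>
  A world accepting a disjunction need not accept a disjunct. But what \<open>y \<lhd> x\<close> rejects is closed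
  under disjunction, so \<open>y\<close> fails to reject one of the disjuncts, and the least committed world
  accepting that disjunct is open to \<open>y\<close>.
\<close>

lemma accepts_disj: "accepts (NDisj \<phi> \<psi>) = canonical.cl (accepts \<phi> \<union> accepts \<psi>)"
proof
  have "accepts \<phi> \<union> accepts \<psi> \<subseteq> accepts (NDisj \<phi> \<psi>)"
    unfolding accepts_def
    by (auto intro: fundamental.trans[OF _ fundamental.disjI1]
        fundamental.trans[OF _ fundamental.disjI2])
  from canonical.cl_mono[OF this]
  show "canonical.cl (accepts \<phi> \<union> accepts \<psi>) \<subseteq> accepts (NDisj \<phi> \<psi>)"
    by (simp add: accepts_closed)
  show "accepts (NDisj \<phi> \<psi>) \<subseteq> canonical.cl (accepts \<phi> \<union> accepts \<psi>)"
  proof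
    fix x assume x: "x \<in> accepts (NDisj \<phi> \<psi>)"
    have "\<exists>z \<in> accepts \<phi> \<union> accepts \<psi>. canon y z" if yx: "canon y x" for y
    proof -
      have "\<not> NDisj \<phi> \<psi> \<turnstile>fund snd y"
        using x yx unfolding accepts_def canon_def by (blast intro: fundamental.trans)
      then obtain \<chi> where \<chi>: "\<chi> = \<phi> \<or> \<chi> = \<psi>" "\<not> \<chi> \<turnstile>fund snd y"
        using fundamental.disjE by blast
      hence "world (\<chi>, NNeg \<chi>)"
        using world_neg by blast
      with \<chi> yx have "(\<chi>, NNeg \<chi>) \<in> accepts \<phi> \<union> accepts \<psi>" "canon y (\<chi>, NNeg \<chi>)"
        by (auto simp: accepts_def canon_def intro: fundamental.refl)
      thus ?thesis by blast
    qed
    with x show "x \<in> canonical.cl (accepts \<phi> \<union> accepts \<psi>)"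
      unfolding canonical.cl_def accepts_def by blast
  qed
qed

lemma accepts_neg: "accepts (NNeg \<phi>) = canonical.cond (accepts \<phi>) {}"
proof (intro equalityI subsetI)
  fix x assume x: "x \<in> accepts (NNeg \<phi>)"
  have "y \<notin> accepts \<phi>" if yx: "canon y x" for y
  proof
    assume "y \<in> accepts \<phi>"
    hence "NNeg \<phi> \<turnstile>fund NNeg (fst y)"
      by (simp add: accepts_def fundamental.contra)
    \<comment> \<open>Hence \<open>y\<close> rejects \<open>\<not> \<phi>\<close>, which \<open>x\<close> accepts.\<close>
    hence "fst x \<turnstile>fund snd y"
      using x yx unfolding accepts_def canon_def world_def by (blast intro: fundamental.trans)
    thus False
      using yx by (simp add: canon_def)
  qed
  with x show "x \<in> canonical.cond (accepts \<phi>) {}"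
    unfolding canonical.cond_empty by (auto simp: accepts_def)
next
  fix x assume x: "x \<in> canonical.cond (accepts \<phi>) {}"
  hence wx: "world x" and none: "\<And>y. canon y x \<Longrightarrow> y \<notin> accepts \<phi>"
    by (auto simp: canonical.cond_empty)
  have "fst x \<turnstile>fund NNeg \<phi>"
  proof (rule ccontr)
    assume nx: "\<not> fst x \<turnstile>fund NNeg \<phi>"
    \<comment> \<open>An inconsistent \<open>\<phi>\<close> would entail the negation of what \<open>x\<close> accepts, so that \<open>x\<close> would
      accept \<open>\<not> \<phi>\<close>.\<close>
    have "\<not> \<phi> \<turnstile>fund NNeg (fst x)"
      using nx fundamental.contra fundamental.negnegI fundamental.trans by blast
    hence w: "world (\<phi>, NNeg \<phi>)"
      by (rule world_neg)
    with wx nx have "canon (\<phi>, NNeg \<phi>) x"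
      by (simp add: canon_def)
    moreover have "(\<phi>, NNeg \<phi>) \<in> accepts \<phi>"
      using w by (simp add: accepts_def fundamental.refl)
    ultimately show False
      using none by blast
  qed
  with wx show "x \<in> accepts (NNeg \<phi>)"
    by (simp add: accepts_def)
qed

lemma truth: "canonical.sem (\<lambda>p. accepts (NVar p)) (embed \<phi>) = accepts \<phi>"
  by (induction \<phi>) (simp_all add: accepts_closed accepts_conj accepts_disj accepts_neg)

lemma F_imp_fundamental:
  assumes "{embed \<phi>} \<turnstile>F embed \<psi>"
  shows "\<phi> \<turnstile>fund \<psi>"
proof (rule ccontr)
  assume not: "\<not> \<phi> \<turnstile>fund \<psi>"
  hence "(\<phi>, NNeg \<phi>) \<in> accepts \<phi>"
    by (simp add: accepts_def world_neg fundamental.refl)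
  moreover have "Collect world \<inter> accepts \<phi> \<subseteq> accepts \<psi>"
    using canonical.soundness[OF assms, of "\<lambda>p. accepts (NVar p)"] by (simp add: truth)
  ultimately show False
    using not by (auto simp: accepts_def)
qed

theorem corollary4p8:
  fixes \<phi> \<psi> :: "'p::countable nform"
  shows "{embed \<phi>} \<turnstile>F embed \<psi> \<longleftrightarrow> \<phi> \<turnstile>fund \<psi>"
  using F_imp_fundamental fundamental_imp_F by blast

end
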